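(* Let $(X,\mathcal{A},\mu)$ be a measure space with $\mu(X)>0$ such that $X$ is not an atom. Then the comaximal graph $\Gamma'_2(\mathcal{M}(X,\mathcal{A}))$ is triangulated if and only if $\mu$ is non-atomic.
   Context: $\mathcal{M}(X,\mathcal{A})$ is the commutative ring (pointwise operations) of all $\mathcal{A}$-measurable functions $f:X\to\mathbb{R}$; $Z(f)=\{x\in X:f(x)=0\}$. A set $A\in\mathcal{A}$ is an atom if $\mu(A)>0$ and $A$ cannot be written as a disjoint union $A=B\sqcup C$ with $B,C\in\mathcal{A}$, $\mu(B)>0$, $\mu(C)>0$; $\mu$ is non-atomic if $\mathcal{A}$ contains no atom. A function $u\in\mathcal{M}(X,\mathcal{A})$ is a $\mu$-unit if $\mu(Z(u))=0$. Write $\mathscr{D}=\{f\in\mathcal{M}(X,\mathcal{A}):\mu(Z(f))>0\text{ and }\mu(X\setminus Z(f))>0\}$, i.e. the functions that are neither $\mu$-units nor equal to $0$ almost everywhere. The comaximal graph $\Gamma'_2(\mathcal{M}(X,\mathcal{A}))$ is the simple graph with vertex set $\mathscr{D}$ in which distinct $f,g$ are adjacent iff the sum of principal ideals $\langle f\rangle+\langle g\rangle$ equals $\langle u\rangle$ for some $\mu$-unit $u$. A graph is triangulated if every vertex is a vertex of a triangle. *)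

theory Defs
  imports "HOL-Analysis.Analysis" "HOL-Algebra.Ideal"
begin

text \<open>
  Elements of the ring are functions on \<open>space M\<close>. They are represented by functions that are
  \<open>undefined\<close> outside \<open>space M\<close>, so that equality of ring elements is equality of
  functions on \<open>space M\<close>.
\<close>

definition meas_fun_ring :: "'a measure \<Rightarrow> ('a \<Rightarrow> real) ring" where
  "meas_fun_ring M =
    \<lparr>carrier = borel_measurable M \<inter> extensional (space M),
     monoid.mult = (\<lambda>f g. \<lambda>x\<in>space M. f x * g x),
     one = (\<lambda>x\<in>space M. 1),
     zero = (\<lambda>x\<in>space M. 0),
     add = (\<lambda>f g. \<lambda>x\<in>space M. f x + g x)\<rparr>"

lemma restrict_borel_measurable:
  assumes "f \<in> borel_measurable M"
  shows "restrict f (space M) \<in> borel_measurable M"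
  using assms by (subst measurable_cong[where g = f]) auto

lemma cring_meas_fun_ring: "cring (meas_fun_ring M)"
proof (rule cringI)
  show "abelian_group (meas_fun_ring M)"
  proof (rule abelian_groupI)
    fix f assume "f \<in> carrier (meas_fun_ring M)"
    then show "\<exists>g\<in>carrier (meas_fun_ring M).
        g \<oplus>\<^bsub>meas_fun_ring M\<^esub> f = \<zero>\<^bsub>meas_fun_ring M\<^esub>"
      by (intro bexI[where x = "\<lambda>x\<in>space M. - f x"])
        (auto simp: meas_fun_ring_def intro!: restrict_borel_measurable)
  qed (auto simp: meas_fun_ring_def algebra_simps extensional_def restrict_def fun_eq_iff
         intro!: restrict_borel_measurable[unfolded restrict_def])
  show "comm_monoid (meas_fun_ring M)"
    by (rule comm_monoidI)
      (auto simp: meas_fun_ring_def algebra_simps extensional_def restrict_def fun_eq_iff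
         intro!: restrict_borel_measurable[unfolded restrict_def])
qed (auto simp: meas_fun_ring_def algebra_simps restrict_def fun_eq_iff)

definition zero_set :: "'a measure \<Rightarrow> ('a \<Rightarrow> real) \<Rightarrow> 'a set" where
  "zero_set M f = {x \<in> space M. f x = 0}"

definition mu_unit :: "'a measure \<Rightarrow> ('a \<Rightarrow> real) \<Rightarrow> bool" where
  "mu_unit M u \<longleftrightarrow> u \<in> carrier (meas_fun_ring M) \<and> emeasure M (zero_set M u) = 0"

definition atom :: "'a measure \<Rightarrow> 'a set \<Rightarrow> bool" where
  "atom M A \<longleftrightarrow> A \<in> sets M \<and> emeasure M A > 0 \<and>
    \<not> (\<exists>B\<in>sets M. \<exists>C\<in>sets M. A = B \<union> C \<and> B \<inter> C = {} \<and> emeasure M B > 0 \<and> emeasure M C > 0)"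

definition non_atomic :: "'a measure \<Rightarrow> bool" where
  "non_atomic M \<longleftrightarrow> \<not> (\<exists>A\<in>sets M. atom M A)"

text \<open>
  A simple graph is given by a vertex set and a symmetric irreflexive adjacency relation.
\<close>

definition triangle :: "'v set \<Rightarrow> ('v \<Rightarrow> 'v \<Rightarrow> bool) \<Rightarrow> 'v \<Rightarrow> 'v \<Rightarrow> 'v \<Rightarrow> bool" where
  "triangle V adj a b c \<longleftrightarrow> a \<in> V \<and> b \<in> V \<and> c \<in> V \<and> distinct [a, b, c] \<and>
    adj a b \<and> adj b c \<and> adj c a"

definition triangulated :: "'v set \<Rightarrow> ('v \<Rightarrow> 'v \<Rightarrow> bool) \<Rightarrow> bool" where
  "triangulated V adj \<longleftrightarrow> (\<forall>a\<in>V. \<exists>b c. triangle V adj a b c)"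

definition comaximal_verts :: "'a measure \<Rightarrow> ('a \<Rightarrow> real) set" where
  "comaximal_verts M = {f \<in> carrier (meas_fun_ring M).
    emeasure M (zero_set M f) > 0 \<and> emeasure M (space M - zero_set M f) > 0}"

definition comaximal_adj :: "'a measure \<Rightarrow> ('a \<Rightarrow> real) \<Rightarrow> ('a \<Rightarrow> real) \<Rightarrow> bool" where
  "comaximal_adj M f g \<longleftrightarrow>
    f \<in> comaximal_verts M \<and> g \<in> comaximal_verts M \<and> f \<noteq> g \<and>
    (\<exists>u. mu_unit M u \<and>
      PIdl\<^bsub>meas_fun_ring M\<^esub> f <+>\<^bsub>meas_fun_ring M\<^esub> PIdl\<^bsub>meas_fun_ring M\<^esub> g
        = PIdl\<^bsub>meas_fun_ring M\<^esub> u)"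

lemma comaximal_adj_irrefl: "\<not> comaximal_adj M f f"
  by (simp add: comaximal_adj_def)

lemma comaximal_adj_sym:
  assumes "comaximal_adj M f g"
  shows "comaximal_adj M g f"
proof -
  interpret cring "meas_fun_ring M" by (rule cring_meas_fun_ring)
  have "f \<in> carrier (meas_fun_ring M)" "g \<in> carrier (meas_fun_ring M)"
    using assms by (auto simp: comaximal_adj_def comaximal_verts_def)
  then have "PIdl\<^bsub>meas_fun_ring M\<^esub> f <+>\<^bsub>meas_fun_ring M\<^esub> PIdl\<^bsub>meas_fun_ring M\<^esub> g =
      PIdl\<^bsub>meas_fun_ring M\<^esub> g <+>\<^bsub>meas_fun_ring M\<^esub> PIdl\<^bsub>meas_fun_ring M\<^esub> f"
    by (intro set_add_comm) (auto simp: cgenideal_def)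
  with assms show ?thesis
    by (auto simp: comaximal_adj_def)
qed

end

theory Submission
  imports Defs
begin

text \<open>
  Since \<open>\<langle>f\<rangle> + \<langle>g\<rangle> = \<langle>f\<^sup>2 + g\<^sup>2\<rangle>\<close>, two vertices are adjacent iff their zero sets meet in a null set.
  A triangle through \<open>f\<close> is thus a splitting, up to null sets, of a part of the complement of \<open>Z(f)\<close>
  into two sets of positive measure. If no atoms exist, the complement of \<open>Z(f)\<close> can always be split;
  if \<open>A\<close> is an atom, then the indicator function of \<open>A\<close> is a vertex, since \<open>X\<close> is not an atom, and
  it lies in no triangle.
\<close>

section \<open>Null sets and sets of positive measure\<close>

lemma zero_set_sets [measurable]: "f \<in> borel_measurable M \<Longrightarrow> zero_set M f \<in> sets M"
  unfolding zero_set_def by measurable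

lemma emeasure_pos_mono:
  "0 < emeasure M A \<Longrightarrow> A \<subseteq> B \<Longrightarrow> B \<in> sets M \<Longrightarrow> 0 < emeasure M B"
  by (rule order.strict_trans2[OF _ emeasure_mono])

lemma emeasure_Un_null_left:
  assumes "A \<in> sets M" "B \<in> sets M" "emeasure M A = 0"
  shows "emeasure M (A \<union> B) = emeasure M B"
  using emeasure_Un_null_set[of B M A] assms by (simp add: null_setsI Un_commute)

lemma emeasure_pos_Diff_null:
  assumes "0 < emeasure M A" "A \<in> sets M" "B \<in> sets M" "emeasure M (A \<inter> B) = 0"
  shows "0 < emeasure M (A - B)"
  using emeasure_Un_null_left[of "A \<inter> B" M "A - B"] assms by (simp add: Int_Diff_Un)

lemma emeasure_pos_Int_null_Diff:
  assumes "0 < emeasure M A" "A \<in> sets M" "B \<in> sets M" "emeasure M (A - B) = 0"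
  shows "0 < emeasure M (A \<inter> B)"
  using emeasure_pos_Diff_null[of M A "A - B"] assms by (simp add: Diff_Diff_Int Int_absorb1)

section \<open>Sums of principal ideals\<close>

lemma in_cgenideal_meas_fun_ring:
  "h \<in> PIdl\<^bsub>meas_fun_ring M\<^esub> f \<longleftrightarrow>
    (\<exists>r \<in> borel_measurable M \<inter> extensional (space M). h = (\<lambda>x\<in>space M. r x * f x))"
  by (auto simp: cgenideal_def meas_fun_ring_def)

lemma in_cgenideal_sum_meas_fun_ring:
  "h \<in> PIdl\<^bsub>meas_fun_ring M\<^esub> f <+>\<^bsub>meas_fun_ring M\<^esub> PIdl\<^bsub>meas_fun_ring M\<^esub> g \<longleftrightarrow>
    (\<exists>r \<in> borel_measurable M \<inter> extensional (space M).
     \<exists>s \<in> borel_measurable M \<inter> extensional (space M). h = (\<lambda>x\<in>space M. r x * f x + s x * g x))"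
  (is "?L = ?R")
proof -
  have "?L \<longleftrightarrow> (\<exists>a \<in> PIdl\<^bsub>meas_fun_ring M\<^esub> f. \<exists>b \<in> PIdl\<^bsub>meas_fun_ring M\<^esub> g.
      h = (\<lambda>x\<in>space M. a x + b x))"
    by (auto simp: set_add_def' meas_fun_ring_def)
  also have "\<dots> \<longleftrightarrow> (\<exists>r \<in> borel_measurable M \<inter> extensional (space M).
      \<exists>s \<in> borel_measurable M \<inter> extensional (space M).
        h = (\<lambda>x\<in>space M. (\<lambda>x\<in>space M. r x * f x) x + (\<lambda>x\<in>space M. s x * g x) x))"
    unfolding Bex_def in_cgenideal_meas_fun_ring by blast
  also have "\<dots> \<longleftrightarrow> ?R"
    by (simp cong: restrict_cong)
  finally show ?thesis .
qed

text \<open>In this ring a function divides every function that vanishes on its zero set, because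
  pointwise quotients are measurable. A real sum of two squares vanishes only where both terms
  do.\<close>

lemma cgenideal_sum_eq_sum_squares:
  assumes f [measurable]: "f \<in> borel_measurable M" and g [measurable]: "g \<in> borel_measurable M"
  shows "PIdl\<^bsub>meas_fun_ring M\<^esub> f <+>\<^bsub>meas_fun_ring M\<^esub> PIdl\<^bsub>meas_fun_ring M\<^esub> g =
    PIdl\<^bsub>meas_fun_ring M\<^esub> (\<lambda>x\<in>space M. f x * f x + g x * g x)"
proof (intro subset_antisym subsetI)
  fix h assume "h \<in> PIdl\<^bsub>meas_fun_ring M\<^esub> f <+>\<^bsub>meas_fun_ring M\<^esub> PIdl\<^bsub>meas_fun_ring M\<^esub> g"
  then obtain r s where [measurable]: "r \<in> borel_measurable M" "s \<in> borel_measurable M"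
    and h: "h = (\<lambda>x\<in>space M. r x * f x + s x * g x)"
    by (auto simp: in_cgenideal_sum_meas_fun_ring)
  \<comment> \<open>The quotient is \<open>0\<close> where \<open>f\<close> and \<open>g\<close> both vanish, and so is \<open>h\<close>.\<close>
  define q where "q = (\<lambda>x\<in>space M. (r x * f x + s x * g x) / (f x * f x + g x * g x))"
  have "q \<in> borel_measurable M"
    unfolding q_def by (rule restrict_borel_measurable) measurable
  moreover have "h = (\<lambda>x\<in>space M. q x * (\<lambda>x\<in>space M. f x * f x + g x * g x) x)"
    by (auto simp: h q_def fun_eq_iff restrict_def sum_squares_eq_zero_iff)
  ultimately show "h \<in> PIdl\<^bsub>meas_fun_ring M\<^esub> (\<lambda>x\<in>space M. f x * f x + g x * g x)"
    unfolding in_cgenideal_meas_fun_ring by (intro bexI[of _ q]) (auto simp: q_def)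
next
  fix h assume "h \<in> PIdl\<^bsub>meas_fun_ring M\<^esub> (\<lambda>x\<in>space M. f x * f x + g x * g x)"
  then obtain r where [measurable]: "r \<in> borel_measurable M"
    and h: "h = (\<lambda>x\<in>space M. r x * (\<lambda>x\<in>space M. f x * f x + g x * g x) x)"
    by (auto simp: in_cgenideal_meas_fun_ring)
  \<comment> \<open>The coefficients come from
    \<open>r * (f * f + g * g) = (r * f) * f + (r * g) * g\<close>.\<close>
  have "(\<lambda>x\<in>space M. r x * f x) \<in> borel_measurable M"
    "(\<lambda>x\<in>space M. r x * g x) \<in> borel_measurable M"
    by (rule restrict_borel_measurable, measurable)+
  moreover have "h = (\<lambda>x\<in>space M. (\<lambda>x\<in>space M. r x * f x) x * f x + (\<lambda>x\<in>space M. r x * g x) x * g x)"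
    by (auto simp: h fun_eq_iff restrict_def algebra_simps)
  ultimately show "h \<in> PIdl\<^bsub>meas_fun_ring M\<^esub> f <+>\<^bsub>meas_fun_ring M\<^esub> PIdl\<^bsub>meas_fun_ring M\<^esub> g"
    unfolding in_cgenideal_sum_meas_fun_ring
    by (intro bexI[of _ "\<lambda>x\<in>space M. r x * f x"] bexI[of _ "\<lambda>x\<in>space M. r x * g x"]) auto
qed

section \<open>Adjacency in terms of zero sets\<close>

lemma comaximal_vertsD:
  assumes "f \<in> comaximal_verts M"
  shows "f \<in> borel_measurable M" "0 < emeasure M (zero_set M f)"
    "0 < emeasure M (space M - zero_set M f)"
  using assms by (auto simp: comaximal_verts_def meas_fun_ring_def)

text \<open>Every element of the ideal sum vanishes where \<open>f\<close> and \<open>g\<close> both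
  do, and the generator \<open>f * f + g * g\<close> vanishes nowhere else.\<close>

lemma comaximal_adj_iff:
  assumes "f \<in> comaximal_verts M" "g \<in> comaximal_verts M"
  shows "comaximal_adj M f g \<longleftrightarrow> emeasure M (zero_set M f \<inter> zero_set M g) = 0"
proof
  have [measurable]: "f \<in> borel_measurable M" "g \<in> borel_measurable M"
    using assms by (auto dest: comaximal_vertsD)
  assume "comaximal_adj M f g"
  then obtain u where u: "mu_unit M u"
    "PIdl\<^bsub>meas_fun_ring M\<^esub> f <+>\<^bsub>meas_fun_ring M\<^esub> PIdl\<^bsub>meas_fun_ring M\<^esub> g =
      PIdl\<^bsub>meas_fun_ring M\<^esub> u"
    by (auto simp: comaximal_adj_def)
  interpret cring "meas_fun_ring M" by (rule cring_meas_fun_ring)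
  have "u \<in> PIdl\<^bsub>meas_fun_ring M\<^esub> u"
    using u(1) by (intro cgenideal_self) (simp add: mu_unit_def)
  then obtain r s where "u = (\<lambda>x\<in>space M. r x * f x + s x * g x)"
    unfolding u(2)[symmetric] in_cgenideal_sum_meas_fun_ring by blast
  then have "zero_set M f \<inter> zero_set M g \<subseteq> zero_set M u"
    by (auto simp: zero_set_def)
  moreover have "emeasure M (zero_set M u) = 0" "u \<in> borel_measurable M"
    using u(1) by (auto simp: mu_unit_def meas_fun_ring_def)
  ultimately show "emeasure M (zero_set M f \<inter> zero_set M g) = 0"
    using emeasure_eq_0[OF zero_set_sets] by blast
next
  assume null: "emeasure M (zero_set M f \<inter> zero_set M g) = 0"
  define u where "u = (\<lambda>x\<in>space M. f x * f x + g x * g x)"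
  have [measurable]: "f \<in> borel_measurable M" "g \<in> borel_measurable M"
    using assms by (auto dest: comaximal_vertsD)
  have "u \<in> borel_measurable M"
    unfolding u_def by (rule restrict_borel_measurable) measurable
  moreover have "zero_set M u = zero_set M f \<inter> zero_set M g"
    by (auto simp: zero_set_def u_def sum_squares_eq_zero_iff)
  ultimately have "mu_unit M u"
    using null by (auto simp: mu_unit_def meas_fun_ring_def u_def)
  \<comment> \<open>If \<open>f = g\<close>, the intersection would be \<open>zero_set M f\<close>,
    which has positive measure.\<close>
  moreover have "f \<noteq> g"
    using null comaximal_vertsD(2)[OF assms(1)] by auto
  ultimately show "comaximal_adj M f g"
    using assms cgenideal_sum_eq_sum_squares[of f M g]
    by (auto simp: comaximal_adj_def u_def)
qed

text \<open>Distinctness of the corners is absorbed by the irreflexivity of adjacency, which leaves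
  a statement about three zero sets.\<close>

lemma triangle_comaximal_iff:
  "triangle (comaximal_verts M) (comaximal_adj M) f g h \<longleftrightarrow>
    f \<in> comaximal_verts M \<and> g \<in> comaximal_verts M \<and> h \<in> comaximal_verts M \<and>
    emeasure M (zero_set M f \<inter> zero_set M g) = 0 \<and>
    emeasure M (zero_set M g \<inter> zero_set M h) = 0 \<and>
    emeasure M (zero_set M h \<inter> zero_set M f) = 0"
  using comaximal_adj_irrefl[of M] comaximal_adj_iff[of _ M]
  unfolding triangle_def by auto

text \<open>Lets vertices be chosen by choosing sets: the indicator of the complement of
  \<open>B\<close> vanishes exactly on \<open>B\<close>.\<close>

lemma exists_comaximal_vert_zero_set:
  assumes B: "B \<in> sets M" and "0 < emeasure M B" "0 < emeasure M (space M - B)"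
  obtains g where "g \<in> comaximal_verts M" "zero_set M g = B"
proof
  let ?g = "\<lambda>x\<in>space M. indicator (space M - B) x :: real"
  have "?g \<in> borel_measurable M"
    using B by (intro restrict_borel_measurable borel_measurable_indicator) auto
  moreover show "zero_set M ?g = B"
    using sets.sets_into_space[OF B] by (auto simp: zero_set_def indicator_def)
  ultimately show "?g \<in> comaximal_verts M"
    using assms by (auto simp: comaximal_verts_def meas_fun_ring_def)
qed

section \<open>Atoms\<close>

lemma not_atom_split:
  assumes "\<not> atom M A" "A \<in> sets M" "0 < emeasure M A"
  obtains B C where "B \<in> sets M" "C \<in> sets M" "A = B \<union> C" "B \<inter> C = {}"
    "0 < emeasure M B" "0 < emeasure M C"
proof -
  have "\<exists>B\<in>sets M. \<exists>C\<in>sets M. A = B \<union> C \<and> B \<inter> C = {} \<and> emeasure M B > 0 \<and> emeasure M C > 0"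
    by (rule contrapos_np[OF assms(1)]) (simp only: atom_def assms simp_thms)
  then show thesis
    by (elim bexE conjE) (rule that)
qed

text \<open>Otherwise \<open>A \<inter> B\<close> and \<open>A - B\<close> would be a splitting of
  the kind that \<open>atom\<close> forbids.\<close>

lemma atom_null_dichotomy:
  assumes "atom M A" "B \<in> sets M"
  shows "emeasure M (A \<inter> B) = 0 \<or> emeasure M (A - B) = 0"
proof (rule ccontr)
  assume "\<not> ?thesis"
  then have "0 < emeasure M (A \<inter> B)" "0 < emeasure M (A - B)"
    by (simp_all add: zero_less_iff_neq_zero)
  moreover have "A \<inter> B \<in> sets M" "A - B \<in> sets M"
    using assms by (auto simp: atom_def)
  moreover have "A = A \<inter> B \<union> (A - B)" "A \<inter> B \<inter> (A - B) = {}"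
    by auto
  ultimately have "\<exists>B\<in>sets M. \<exists>C\<in>sets M. A = B \<union> C \<and> B \<inter> C = {} \<and>
      emeasure M B > 0 \<and> emeasure M C > 0"
    by (intro bexI[of _ "A \<inter> B"] bexI[of _ "A - B"] conjI)
  with assms(1) show False
    by (simp add: atom_def)
qed

text \<open>If the complement of \<open>A\<close> were null, a splitting of the whole space would
  restrict to a splitting of \<open>A\<close> into two parts of positive measure. It makes the
  indicator of an atom a vertex.\<close>

lemma atom_complement_pos:
  assumes "emeasure M (space M) > 0" "\<not> atom M (space M)" "atom M A"
  shows "0 < emeasure M (space M - A)"
proof (rule ccontr)
  assume "\<not> 0 < emeasure M (space M - A)"
  then have null: "emeasure M (space M - A) = 0" by simp
  have A [measurable]: "A \<in> sets M"
    using assms(3) by (simp add: atom_def)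
  obtain B C where [measurable]: "B \<in> sets M" "C \<in> sets M"
    and BC: "space M = B \<union> C" "B \<inter> C = {}" "0 < emeasure M B" "0 < emeasure M C"
    using not_atom_split[OF assms(2) sets.top assms(1)] by metis
  have "emeasure M (B - A) = 0" "emeasure M (C - A) = 0"
    using BC(1) by (auto intro!: emeasure_eq_0[OF _ null])
  then have "0 < emeasure M (B \<inter> A)" "0 < emeasure M (C \<inter> A)"
    using BC by (auto intro!: emeasure_pos_Int_null_Diff)
  \<comment> \<open>Since \<open>B\<close> and \<open>C\<close> are disjoint,
    \<open>C \<inter> A\<close> lies in \<open>A - B\<close>.\<close>
  then have "0 < emeasure M (A \<inter> B)" "0 < emeasure M (A - B)"
    using BC(2) by (auto simp: Int_commute intro: emeasure_pos_mono[of M "A \<inter> C"])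
  then show False
    using atom_null_dichotomy[OF assms(3), of B] by auto
qed

theorem theorem3p17:
  fixes M :: "'a measure"
  assumes "emeasure M (space M) > 0"
    and "\<not> atom M (space M)"
  shows "triangulated (comaximal_verts M) (comaximal_adj M) \<longleftrightarrow> non_atomic M"
proof
  assume tri: "triangulated (comaximal_verts M) (comaximal_adj M)"
  show "non_atomic M"
    unfolding non_atomic_def
  proof (rule notI, elim bexE)
    fix A assume A [measurable]: "A \<in> sets M" and atom: "atom M A"
    have A_eq: "space M - (space M - A) = A"
      using sets.sets_into_space[OF A] by auto
    \<comment> \<open>The vertex to test is the indicator of \<open>A\<close>; by
      \<open>A_eq\<close> it arises from the zero set \<open>space M - A\<close>.\<close>
    obtain f where f: "f \<in> comaximal_verts M" "zero_set M f = space M - A"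
      using exists_comaximal_vert_zero_set[of "space M - A" M] atom
        atom_complement_pos[OF assms atom] A by (auto simp: A_eq atom_def)
    obtain g h where g: "g \<in> comaximal_verts M" and h: "h \<in> comaximal_verts M"
      and null: "emeasure M ((space M - A) \<inter> zero_set M g) = 0"
        "emeasure M (zero_set M g \<inter> zero_set M h) = 0"
        "emeasure M (zero_set M h \<inter> (space M - A)) = 0"
      using tri f unfolding triangulated_def triangle_comaximal_iff by metis
    let ?G = "zero_set M g" and ?H = "zero_set M h"
    have [measurable]: "?G \<in> sets M" "?H \<in> sets M"
      using g h by (auto dest: comaximal_vertsD)
    \<comment> \<open>Adjacency to \<open>f\<close> leaves only null parts of \<open>?G\<close> and
      \<open>?H\<close> outside \<open>A\<close>, so both meet \<open>A\<close> in positive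
      measure.\<close>
    have "emeasure M (?G - A) = 0"
      by (rule emeasure_eq_0[OF _ null(1)]) (measurable, auto simp: zero_set_def)
    moreover have "emeasure M (?H - A) = 0"
      by (rule emeasure_eq_0[OF _ null(3)]) (measurable, auto simp: zero_set_def)
    ultimately have pos: "0 < emeasure M (?G \<inter> A)" "0 < emeasure M (?H \<inter> A)"
      using g h by (auto intro!: emeasure_pos_Int_null_Diff dest: comaximal_vertsD)
    \<comment> \<open>As \<open>?H\<close> is almost disjoint from \<open>?G\<close>, it provides
      the part of \<open>A\<close> outside \<open>?G\<close> that contradicts the dichotomy.\<close>
    have "emeasure M (?H \<inter> A \<inter> ?G) = 0"
      by (rule emeasure_eq_0[OF _ null(2)]) auto
    with pos(2) have "0 < emeasure M (?H \<inter> A - ?G)"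
      by (auto intro!: emeasure_pos_Diff_null)
    then have "0 < emeasure M (A - ?G)"
      by (rule emeasure_pos_mono) auto
    with pos(1) show False
      using atom_null_dichotomy[OF atom, of ?G] by (auto simp: Int_commute)
  qed
next
  assume na: "non_atomic M"
  show "triangulated (comaximal_verts M) (comaximal_adj M)"
    unfolding triangulated_def
  proof
    fix f assume f: "f \<in> comaximal_verts M"
    then have [measurable]: "f \<in> borel_measurable M"
      by (rule comaximal_vertsD)
    have X: "space M - zero_set M f \<in> sets M" by measurable
    then have "\<not> atom M (space M - zero_set M f)"
      using na by (auto simp: non_atomic_def)
    from not_atom_split[OF this X comaximal_vertsD(3)[OF f]] obtain B C where BC [measurable]: "B \<in> sets M" "C \<in> sets M"
      and split: "space M - zero_set M f = B \<union> C" "B \<inter> C = {}" "0 < emeasure M B" "0 < emeasure M C"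
      by metis
    \<comment> \<open>Each of \<open>B\<close> and \<open>C\<close> lies in the complement of the
      other, so both qualify as zero sets of vertices.\<close>
    have "0 < emeasure M (space M - B)" "0 < emeasure M (space M - C)"
      using split sets.sets_into_space[OF BC(1)] sets.sets_into_space[OF BC(2)]
      by (auto intro: emeasure_pos_mono[of M C] emeasure_pos_mono[of M B])
    then obtain g h where g: "g \<in> comaximal_verts M" "zero_set M g = B"
      and h: "h \<in> comaximal_verts M" "zero_set M h = C"
      using exists_comaximal_vert_zero_set BC split(3,4) by metis
    \<comment> \<open>The zero sets of the three corners are pairwise disjoint, not merely almost
      disjoint.\<close>
    have "zero_set M f \<inter> B = {}" "C \<inter> zero_set M f = {}"
      using split(1) by auto
    then show "\<exists>g h. triangle (comaximal_verts M) (comaximal_adj M) f g h"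
      using f g h split(2) unfolding triangle_comaximal_iff
      by (intro exI[of _ g] exI[of _ h]) simp
  qed
qed

end
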